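(* Let $G_n$ ($n\ge0$) be the approximating multigraphs of the non-p.c.f. analog of the Sierpiński gasket. Then the number of spanning trees of $G_n$ is $$\tau(G_n)=2^{f_n}\cdot3^{g_n}\cdot5^{h_n},\qquad n\ge0,$$ where $f_n=\frac{2}{25}(11\cdot6^n-30n-11)$, $g_n=\frac15(2\cdot6^n+3)$, and $h_n=\frac1{25}(4\cdot6^n+30n-4)$.
   Context: The non-p.c.f. analog of the Sierpiński gasket is the self-affine set in $\mathbb{R}^2$ generated by six affine contractions: one with fixed point $(0,0)$ and linear part $\begin{pmatrix}1/2&1/6\\1/4&1/4\end{pmatrix}$, the other five obtained by conjugating it with the symmetries of the equilateral triangle with vertices $(0,0),(1,0),(1/2,\sqrt3/2)$. Its approximating graphs are described combinatorially as multigraphs built from triangles: $G_0$ is a single triangle (3-cycle) on vertices $x_1,x_2,x_3$. $G_n$ is obtained from $G_{n-1}$ by replacing each triangle with vertices $a,b,c$ by six triangles, using four new vertices $m_{ab},m_{bc},m_{ca},o$ (distinct for distinct triangles): $\{a,m_{ab},o\},\{m_{ab},b,o\},\{b,m_{bc},o\},\{m_{bc},c,o\},\{c,m_{ca},o\},\{m_{ca},a,o\}$. The edge multiset of $G_n$ is the multiset union of the three edges of each of its triangles (so e.g. in $G_1$ the edge $x_1o$ has multiplicity 2). Spanning trees of a multigraph distinguish parallel edges. *)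

theory Defs
  imports Complex_Main
begin

text \<open>
  Undirected multigraphs with identifiable edges, each carrying its set of end
  vertices. The \<open>spanning_tree\<close> of the AFP entry Graph_Theory is not usable here: its
  \<open>forest\<close> excludes only directed cycles, so an acyclically oriented triangle counts as
  a tree there.
\<close>

record ('v, 'e) multigraph =
  verts :: "'v set"
  edges :: "'e set"
  ends :: "'e \<Rightarrow> 'v set"

definition adjacency :: "('v, 'e) multigraph \<Rightarrow> ('v \<times> 'v) set" where
  "adjacency G = {(u, v). \<exists>e \<in> edges G. ends G e = {u, v}}"

definition connected_multigraph :: "('v, 'e) multigraph \<Rightarrow> bool" where
  "connected_multigraph G \<longleftrightarrow>
     verts G \<noteq> {} \<and> (\<forall>u \<in> verts G. \<forall>v \<in> verts G. (u, v) \<in> (adjacency G)\<^sup>*)"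

text \<open>
  A cycle visits the distinct vertices \<open>vs\<close> cyclically along the distinct edges \<open>es\<close>. The
  lengths 1 and 2 are allowed: these are a loop and a pair of parallel edges.
\<close>

definition is_cycle :: "('v, 'e) multigraph \<Rightarrow> 'v list \<Rightarrow> 'e list \<Rightarrow> bool" where
  "is_cycle G vs es \<longleftrightarrow>
     es \<noteq> [] \<and> length vs = length es \<and> distinct vs \<and> distinct es \<and>
     set vs \<subseteq> verts G \<and> set es \<subseteq> edges G \<and>
     (\<forall>i < length es. ends G (es ! i) = {vs ! i, vs ! (Suc i mod length es)})"

definition is_tree :: "('v, 'e) multigraph \<Rightarrow> bool" where
  "is_tree G \<longleftrightarrow> connected_multigraph G \<and> (\<nexists>vs es. is_cycle G vs es)"

definition spanning_trees :: "('v, 'e) multigraph \<Rightarrow> 'e set set" where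
  "spanning_trees G = {T. T \<subseteq> edges G \<and> is_tree (G\<lparr>edges := T\<rparr>)}"

definition \<tau> :: "('v, 'e) multigraph \<Rightarrow> nat" where
  "\<tau> G = card (spanning_trees G)"

text \<open>
  Replacing the triangle \<open>(a, b, c)\<close> creates the vertices \<open>Mab a b c\<close>, \<open>Mbc a b c\<close>,
  \<open>Mca a b c\<close> and \<open>Ctr a b c\<close>. Being constructor terms over the whole triangle, they
  differ from all vertices created so far and from those created for other triangles.
\<close>

datatype vertex =
    X1 | X2 | X3
  | Mab vertex vertex vertex
  | Mbc vertex vertex vertex
  | Mca vertex vertex vertex
  | Ctr vertex vertex vertex

type_synonym triangle = "vertex \<times> vertex \<times> vertex"

fun subdivide :: "triangle \<Rightarrow> triangle set" where
  "subdivide (a, b, c) =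
     {(a, Mab a b c, Ctr a b c), (Mab a b c, b, Ctr a b c),
      (b, Mbc a b c, Ctr a b c), (Mbc a b c, c, Ctr a b c),
      (c, Mca a b c, Ctr a b c), (Mca a b c, a, Ctr a b c)}"

fun triangles :: "nat \<Rightarrow> triangle set" where
  "triangles 0 = {(X1, X2, X3)}"
| "triangles (Suc n) = (\<Union>t \<in> triangles n. subdivide t)"

datatype side = AB | BC | CA

fun side_ends :: "triangle \<times> side \<Rightarrow> vertex set" where
  "side_ends ((a, b, c), AB) = {a, b}"
| "side_ends ((a, b, c), BC) = {b, c}"
| "side_ends ((a, b, c), CA) = {c, a}"

text \<open>
  An edge is a triangle together with one of its sides, so sides of different triangles
  with the same ends are parallel edges. This realizes the multiset union.
\<close>

definition gasket_graph :: "nat \<Rightarrow> (vertex, triangle \<times> side) multigraph" where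
  "gasket_graph n =
     \<lparr> verts = (\<Union>(a, b, c) \<in> triangles n. {a, b, c}),
       edges = triangles n \<times> UNIV,
       ends = side_ends \<rparr>"

end

theory Submission
  imports Defs "HOL-Library.Multiset"
begin

text \<open>
  The weighted number of spanning trees behaves under the star-triangle transformation as
  under electrical reduction: a vertex \<open>m\<close> joined to \<open>a, b, c\<close> by edges of weights \<open>x, y, z\<close>
  may be replaced by a triangle with weights \<open>xy/s, yz/s, zx/s\<close>, where \<open>s = x + y + z\<close>, at the
  cost of the factor \<open>s\<close>. Eliminating the four new vertices of a subdivided triangle in this
  way returns the triangle with weight \<open>5/4\<close> on each side, with total factor
  \<open>4 * 4 * 4 * 9 = 576\<close>. A spanning tree has one edge fewer than there are vertices, and \<open>G\<^sub>n\<close>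
  has \<open>6 ^ n\<close> triangles and \<open>(4 * 6 ^ n + 11) / 5\<close> vertices, so
  \<open>\<tau>(G\<^sub>n\<^sub>+\<^sub>1) = 576 ^ (6 ^ n) * (5/4) ^ ((4 * 6 ^ n + 6) / 5) * \<tau>(G\<^sub>n)\<close>.
\<close>

section \<open>Weighted spanning tree sums by deletion and contraction\<close>

text \<open>For an equivalence relation \<open>R\<close> this is the equivalence relation generated
  by \<open>R\<close> and the pair \<open>u\<close>, \<open>v\<close> (see \<open>join_le\<close>).
  At most two classes merge, so a single passage between them suffices and no closure is
  taken.\<close>

definition join :: "('v \<Rightarrow> 'v \<Rightarrow> bool) \<Rightarrow> 'v \<Rightarrow> 'v \<Rightarrow> 'v \<Rightarrow> 'v \<Rightarrow> bool" where
  "join R u v x y \<longleftrightarrow> R x y \<or> R x u \<and> R v y \<or> R x v \<and> R u y"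

lemma equivpD:
  assumes "equivp R"
  shows "R x x" "R x y \<Longrightarrow> R y x" "R x y \<Longrightarrow> R y z \<Longrightarrow> R x z"
  using assms by (auto elim: equivpE dest: reflpD sympD transpD)

lemma equivp_join: "equivp R \<Longrightarrow> equivp (join R u v)"
  by (rule equivpI; unfold reflp_def symp_def transp_def join_def) (meson equivpD)+

lemma join_commute_ends: "equivp R \<Longrightarrow> join R u v = join R v u"
  by (intro ext) (auto simp: join_def)

lemma join_commute: "equivp R \<Longrightarrow> join (join R u v) x y = join (join R x y) u v"
  by (intro ext; unfold join_def) (meson equivpD)

text \<open>The exchange property of the graphic matroid: if \<open>x\<close> and \<open>y\<close>
  become related only through \<open>u\<close> and \<open>v\<close>, then relating \<open>x\<close>
  and \<open>y\<close> links the classes of \<open>u\<close> and \<open>v\<close>.\<close>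

lemma join_exchange:
  "equivp R \<Longrightarrow> \<not> R x y \<Longrightarrow> join R u v x y \<Longrightarrow> join R x y u v"
  unfolding join_def by (meson equivpD)

text \<open>
  The weighted number of edge sets that complete the equivalence relation \<open>R\<close> on \<open>V\<close> to a
  spanning tree, by deletion and contraction. Contracting an edge coarsens \<open>R\<close> instead of
  changing the vertices, so contractions commute on the nose.
\<close>

fun tree_sum :: "'v set \<Rightarrow> ('v \<times> 'v \<times> real) list \<Rightarrow> ('v \<Rightarrow> 'v \<Rightarrow> bool) \<Rightarrow> real" where
  "tree_sum V [] R = (if \<forall>x\<in>V. \<forall>y\<in>V. R x y then 1 else 0)"
| "tree_sum V ((u, v, w) # es) R =
     tree_sum V es R + (if R u v then 0 else w * tree_sum V es (join R u v))"

text \<open>Both sides expand over the four ways of using \<open>e\<close> and \<open>f\<close>.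
  Contractions commute by \<open>join_commute\<close>, and by \<open>join_exchange\<close> one order
  meets a loop at its second edge exactly when the other does.\<close>

lemma tree_sum_swap:
  assumes "equivp R"
  shows "tree_sum V (e # f # es) R = tree_sum V (f # e # es) R"
proof -
  obtain u v w x y z where [simp]: "e = (u, v, w)" "f = (x, y, z)"
    by (metis prod_cases3)
  have *: "join (join R u v) x y = join (join R x y) u v"
    using assms by (rule join_commute)
  have mono: "join R a b c d" if "R c d" for a b c d
    using that by (simp add: join_def)
  show ?thesis
    using join_exchange[OF assms, of x y u v] join_exchange[OF assms, of u v x y]
    by (auto simp: * algebra_simps mono)
qed

lemma tree_sum_move_front:
  "equivp R \<Longrightarrow> tree_sum V (xs @ e # ys) R = tree_sum V (e # xs @ ys) R"
proof (induction xs arbitrary: R)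
  case (Cons f xs)
  obtain x y z where f: "f = (x, y, z)" by (metis prod_cases3)
  have "tree_sum V (f # xs @ e # ys) R = tree_sum V (f # e # xs @ ys) R"
    unfolding f using Cons.IH[OF Cons.prems] Cons.IH[OF equivp_join[OF Cons.prems]]
    by simp
  then show ?case using tree_sum_swap[OF Cons.prems] by simp
qed simp

lemma tree_sum_flip:
  "equivp R \<Longrightarrow> tree_sum V ((u, v, w) # es) R = tree_sum V ((v, u, w) # es) R"
  using join_commute_ends[of R u v] equivpD(2)[of R u v] equivpD(2)[of R v u] by auto

fun unoriented :: "'v \<times> 'v \<times> real \<Rightarrow> 'v set \<times> real" where
  "unoriented (u, v, w) = ({u, v}, w)"

text \<open>The first edge of \<open>es\<close> is located in \<open>fs\<close>, moved to the front
  and flipped if necessary. Later proofs use this to rearrange explicit edge lists freely.\<close>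

lemma tree_sum_cong:
  "equivp R \<Longrightarrow> mset (map unoriented es) = mset (map unoriented fs) \<Longrightarrow>
    tree_sum V es R = tree_sum V fs R"
proof (induction es arbitrary: fs R)
  case (Cons e es)
  obtain x y z where e: "e = (x, y, z)" by (metis prod_cases3)
  have "unoriented e \<in> set (map unoriented fs)"
    using Cons.prems(2) by (metis list.set_intros(1) list.simps(9) mset_eq_setD)
  then obtain f where "f \<in> set fs" and ef: "unoriented e = unoriented f" by auto
  then obtain xs ys where fs: "fs = xs @ f # ys" by (meson split_list)
  then have m: "mset (map unoriented es) = mset (map unoriented (xs @ ys))"
    using Cons.prems(2) ef by simp
  have "tree_sum V (e # es) R = tree_sum V (e # xs @ ys) R"
    unfolding e using Cons.IH[OF Cons.prems(1) m] Cons.IH[OF equivp_join[OF Cons.prems(1)] m]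
    by simp
  also have "\<dots> = tree_sum V (f # xs @ ys) R"
  proof -
    obtain x' y' z' where f: "f = (x', y', z')" by (metis prod_cases3)
    then have "f = (x, y, z) \<or> f = (y, x, z)" using ef e by (auto simp: doubleton_eq_iff)
    then show ?thesis using e tree_sum_flip[OF Cons.prems(1)] by auto
  qed
  finally show ?case using tree_sum_move_front[OF Cons.prems(1)] fs by simp
qed simp

text \<open>Once one of two parallel edges is contracted the other is a loop, so at most one of them
  is used and the weights add.\<close>

lemma tree_sum_parallel:
  "equivp R \<Longrightarrow>
    tree_sum V ((u, v, w) # (u, v, z) # es) R = tree_sum V ((u, v, w + z) # es) R"
  using equivpD(1)[of R] by (auto simp: join_def algebra_simps)

text \<open>No edge touches \<open>m\<close>, so its class remains a singleton under every
  contraction and never reaches \<open>a\<close>.\<close>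

lemma tree_sum_isolated:
  assumes "equivp R" "\<And>x. R m x \<Longrightarrow> x = m" "a \<in> V" "m \<notin> V"
    "\<forall>(u, v, w) \<in> set es. m \<noteq> u \<and> m \<noteq> v"
  shows "tree_sum (insert m V) es R = 0"
  using assms(1,2,5)
proof (induction es arbitrary: R)
  case Nil
  then show ?case using assms(3,4) by auto
next
  case (Cons e es)
  obtain u v w where e: "e = (u, v, w)" by (metis prod_cases3)
  have i: "join R u v m x \<Longrightarrow> x = m" for x
    using Cons.prems e unfolding join_def by auto
  show ?case
    using Cons.IH[OF Cons.prems(1,2)] Cons.IH[OF equivp_join[OF Cons.prems(1)] i] Cons.prems e
    by auto
qed

text \<open>With \<open>m\<close> attached to \<open>a\<close> alone, connecting
  \<open>insert m V\<close> amounts to connecting \<open>V\<close>. Attaching \<open>m\<close>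
  commutes with the contractions of \<open>es\<close> and changes none of their loop tests, as no
  edge of \<open>es\<close> touches \<open>m\<close>.\<close>

lemma tree_sum_pendant:
  assumes "equivp R" "\<And>x. R m x \<Longrightarrow> x = m" "a \<in> V" "m \<notin> V"
    "\<forall>(u, v, w) \<in> set es. m \<noteq> u \<and> m \<noteq> v"
  shows "tree_sum (insert m V) es (join R m a) = tree_sum V es R"
  using assms(1,2,5)
proof (induction es arbitrary: R)
  case Nil
  have s: "R x m \<Longrightarrow> x = m" for x using Nil(1,2) by (meson equivpD)
  have "(\<forall>x\<in>insert m V. \<forall>y\<in>insert m V. join R m a x y) \<longleftrightarrow> (\<forall>x\<in>V. \<forall>y\<in>V. R x y)"
    (is "?l = ?r")
  proof
    show ?r if ?l
      using that s Nil(2) assms(4) unfolding join_def by (metis insertCI)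
    show ?l if ?r
      using that assms(3) equivpD(1)[OF Nil(1)] unfolding join_def by blast
  qed
  then show ?case by simp
next
  case (Cons e es)
  obtain u v w where e: "e = (u, v, w)" by (metis prod_cases3)
  have s: "R x m \<Longrightarrow> x = m" for x using Cons(2,3) by (meson equivpD)
  have mu: "m \<noteq> u" "m \<noteq> v" using Cons.prems e by auto
  have i: "join R u v m x \<Longrightarrow> x = m" for x
    using Cons.prems e unfolding join_def by auto
  have "join R m a u v = R u v"
    using mu Cons(3) s unfolding join_def by metis
  then show ?case
    using Cons.IH[OF Cons.prems(1,2)] Cons.IH[OF equivp_join[OF Cons.prems(1)] i] Cons.prems e
    by (auto simp: join_commute[of R m a])
qed

section \<open>The star-triangle transformation\<close>

text \<open>Trades a second edge at \<open>m\<close> for a relation between its neighbours, so that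
  \<open>m\<close> becomes pendant and \<open>tree_sum_pendant\<close> applies.\<close>

lemma join_star:
  assumes "equivp R"
  shows "join (join R m a) m b = join (join R a b) m a"
  unfolding join_def using equivpD[OF assms] by (intro ext) meson

text \<open>Both sides are expanded over the subsets of the three explicit edges and compared as
  combinations of five sums over \<open>es\<close>, one for each partition of \<open>a\<close>,
  \<open>b\<close>, \<open>c\<close>. In the star, no edge contributes 0, one edge leaves the
  corners apart, two edges join two corners and three edges join all of them. In the triangle, any
  two sides join all corners and make the third a loop.\<close>

lemma tree_sum_star_triangle:
  fixes m :: 'v
  assumes d: "distinct [m, a, b, c]" and V: "a \<in> V" "b \<in> V" "c \<in> V" "m \<notin> V"
    and es: "\<forall>(u, v, w) \<in> set es. m \<noteq> u \<and> m \<noteq> v" and s: "x + y + z \<noteq> 0"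
  shows "tree_sum (insert m V) ((m, a, x) # (m, b, y) # (m, c, z) # es) (=) =
    (x + y + z) * tree_sum V ((a, b, x * y / (x + y + z)) # (b, c, y * z / (x + y + z)) #
      (c, a, z * x / (x + y + z)) # es) (=)"
proof -
  let ?I = "(=) :: 'v \<Rightarrow> 'v \<Rightarrow> bool"
  let ?all = "join (join ?I a b) a c"
  have eq: "equivp ?I" by (rule identity_equivp)
  note eqj = equivp_join[OF eq]
  have pend: "tree_sum (insert m V) es (join R m v) = tree_sum V es R"
    if "equivp R" "\<And>x. R m x \<Longrightarrow> x = m" "v \<in> V" for R v
    using tree_sum_pendant[OF that V(4) es] .
  have iso: "x = m" if "join ?I u v m x" "m \<noteq> u" "m \<noteq> v" for u v x
    using that by (auto simp: join_def)
  have iso2: "x = m" if "join (join ?I u v) u' v' m x" "m \<noteq> u" "m \<noteq> v" "m \<noteq> u'" "m \<noteq> v'"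
    for u v u' v' x
    using that by (auto simp: join_def)
  have none: "tree_sum (insert m V) es ?I = 0"
    using tree_sum_isolated[OF eq _ V(1,4) es] by simp
  have one: "tree_sum (insert m V) es (join ?I m v) = tree_sum V es ?I" if "v \<in> V" for v
    using pend[OF eq _ that] by simp
  have two: "tree_sum (insert m V) es (join (join ?I m u) m v) = tree_sum V es (join ?I u v)"
    if "u \<in> V" "v \<in> V" for u v
    by (subst join_star[OF eq], rule pend[OF eqj _ that(1)]) (use iso that V in blast)
  have three: "tree_sum (insert m V) es (join (join (join ?I m a) m b) m c) = tree_sum V es ?all"
    by (subst join_star[OF eq], subst join_star[OF eqj], rule pend[OF equivp_join[OF eqj] _ V(1)])
      (use iso2 V in blast)
  have all1: "join (join ?I a b) b c = ?all"
    by (intro ext) (auto simp: join_def)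
  have all2: "join (join ?I a b) c a = ?all"
    by (intro ext) (auto simp: join_def)
  have all3: "join (join ?I b c) c a = ?all"
    by (intro ext) (auto simp: join_def)
  have ca: "join ?I c a = join ?I a c"
    by (intro ext) (auto simp: join_def)
  have ne: "a \<noteq> b" "b \<noteq> c" "a \<noteq> c" "b \<noteq> a" "c \<noteq> b" "c \<noteq> a" "m \<noteq> a" "m \<noteq> b" "m \<noteq> c"
    "a \<noteq> m" "b \<noteq> m" "c \<noteq> m"
    using d by auto
  let ?S0 = "tree_sum V es ?I" and ?S1 = "tree_sum V es (join ?I a b)"
    and ?S2 = "tree_sum V es (join ?I b c)" and ?S3 = "tree_sum V es (join ?I a c)"
    and ?S4 = "tree_sum V es ?all"
  have "\<not> join ?I m b m c" "\<not> join ?I m a m b" "\<not> join ?I m a m c"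
    "\<not> join (join ?I m a) m b m c" "\<not> join ?I a b b c" "\<not> join ?I a b c a" "\<not> join ?I b c c a"
    "join (join ?I a b) b c c a"
    using ne by (auto simp: join_def)
  note cond = this ne
  have l: "tree_sum (insert m V) ((m, a, x) # (m, b, y) # (m, c, z) # es) ?I =
     (x + y + z) * ?S0 + x * y * ?S1 + y * z * ?S2 + z * x * ?S3 + x * y * z * ?S4"
    using cond V by (simp add: none one two three algebra_simps)
  have all1': "join (join ?I a b) a c c a" using ne by (auto simp: join_def)
  have r: "tree_sum V ((a, b, p) # (b, c, q) # (c, a, r) # es) ?I =
     ?S0 + p * ?S1 + q * ?S2 + r * ?S3 + (p * q + q * r + r * p) * ?S4" for p q r
    using cond all1' by (simp add: all1 all2 all3 ca algebra_simps)
  let ?s = "x + y + z"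
  \<comment> \<open>The denominator is a separate \<open>k\<close>, so that
    \<open>field_simps\<close> cancels it as an atom; afterwards \<open>k\<close> becomes the sum of
    the weights and the last quotient is 1.\<close>
  have "k * ((x * y / k) * (y * z / k) + (y * z / k) * (z * x / k) + (z * x / k) * (x * y / k))
      = x * y * z * ((x + y + z) / k)" if "k \<noteq> 0" for k
    using that by (simp add: field_simps)
  from this[OF s]
  have q: "?s * ((x * y / ?s) * (y * z / ?s) + (y * z / ?s) * (z * x / ?s) + (z * x / ?s) * (x * y / ?s))
      = x * y * z"
    using s by simp
  have dist: "k * (A + p * B + q * C + r * D + t * E) = k * A + (k * p) * B + (k * q) * C +
      (k * r) * D + (k * t) * E" for k A B C D E p q r t :: real
    by (simp add: algebra_simps)
  have div: "?s * (p / ?s) = p" for p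
    using s by simp
  show ?thesis
    unfolding l r dist q div ..
qed

section \<open>Spanning trees by deletion and contraction\<close>

text \<open>The equivalence relation generated by \<open>R\<close> and the edges of
  \<open>T\<close>, as the intersection of all equivalence relations containing both. In this form
  contraction (\<open>conn_insert\<close>) follows from \<open>join_le\<close> by rewriting.\<close>

definition conn :: "('e \<Rightarrow> 'v \<times> 'v) \<Rightarrow> ('v \<Rightarrow> 'v \<Rightarrow> bool) \<Rightarrow> 'e set \<Rightarrow> 'v \<Rightarrow> 'v \<Rightarrow> bool" where
  "conn p R T x y \<longleftrightarrow>
     (\<forall>S. equivp S \<and> R \<le> S \<and> (\<forall>e\<in>T. S (fst (p e)) (snd (p e))) \<longrightarrow> S x y)"

lemma conn_least:
  assumes "conn p R T x y" "equivp S" "R \<le> S" "\<And>e. e \<in> T \<Longrightarrow> S (fst (p e)) (snd (p e))"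
  shows "S x y"
  using assms(1)[unfolded conn_def, THEN spec, of S] assms(2-4) by simp

lemma equivp_conn: "equivp (conn p R T)"
proof (intro equivpI reflpI sympI transpI; unfold conn_def[of p R T]; intro allI impI)
  fix x S
  assume "equivp S \<and> R \<le> S \<and> (\<forall>e\<in>T. S (fst (p e)) (snd (p e)))"
  then show "S x x" using equivpD(1)[of S] by simp
next
  fix x y S
  assume "\<forall>S. equivp S \<and> R \<le> S \<and> (\<forall>e\<in>T. S (fst (p e)) (snd (p e))) \<longrightarrow> S x y"
    and S: "equivp S \<and> R \<le> S \<and> (\<forall>e\<in>T. S (fst (p e)) (snd (p e)))"
  then have "S x y" by blast
  then show "S y x" using S equivpD(2)[of S] by simp
next
  fix x y z S
  assume "\<forall>S. equivp S \<and> R \<le> S \<and> (\<forall>e\<in>T. S (fst (p e)) (snd (p e))) \<longrightarrow> S x y"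
    and "\<forall>S. equivp S \<and> R \<le> S \<and> (\<forall>e\<in>T. S (fst (p e)) (snd (p e))) \<longrightarrow> S y z"
    and S: "equivp S \<and> R \<le> S \<and> (\<forall>e\<in>T. S (fst (p e)) (snd (p e)))"
  then have "S x y" "S y z" by blast+
  then show "S x z" using S equivpD(3)[of S x y z] by simp
qed

lemma conn_base: "R x y \<Longrightarrow> conn p R T x y"
  by (auto simp: conn_def)

lemma conn_base_le: "R \<le> conn p R T"
  by (auto intro: conn_base)

lemma conn_edge: "e \<in> T \<Longrightarrow> conn p R T (fst (p e)) (snd (p e))"
  by (simp add: conn_def)

lemma conn_mono: "conn p R S x y \<Longrightarrow> S \<subseteq> T \<Longrightarrow> conn p R T x y"
  by (auto simp: conn_def)

lemma conn_empty: "equivp R \<Longrightarrow> conn p R {} = R"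
  by (intro ext iffI conn_base) (erule conn_least[where S = R]; simp)

lemma join_le: "equivp S \<Longrightarrow> join R u v \<le> S \<longleftrightarrow> R \<le> S \<and> S u v" if "equivp R"
proof
  assume S: "equivp S"
  show "R \<le> S \<and> S u v" if "join R u v \<le> S"
    using that equivpD(1)[OF \<open>equivp R\<close>] by (auto simp: join_def le_fun_def)
  show "join R u v \<le> S" if "R \<le> S \<and> S u v"
    using that equivpD[OF S] unfolding join_def le_fun_def le_bool_def by meson
qed

lemma conn_insert:
  assumes "equivp R"
  shows "conn p R (insert e T) = conn p (join R (fst (p e)) (snd (p e))) T"
  by (intro ext) (simp add: conn_def join_le[OF assms] conj_assoc cong: conj_cong)

text \<open>In \<open>conn_insert\<close> the edge is added before those of \<open>T\<close>, here
  after them; this is the form to which \<open>join_exchange\<close> applies.\<close>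

lemma conn_insert_eq_join:
  "conn p R (insert e T) = join (conn p R T) (fst (p e)) (snd (p e))" (is "_ = ?j")
proof (intro ext iffI)
  have eq: "equivp ?j" by (rule equivp_join[OF equivp_conn])
  have le: "conn p R T \<le> ?j" "?j (fst (p e)) (snd (p e))"
    using join_le[OF equivp_conn eq, THEN iffD1, OF order_refl] by simp_all
  fix x y
  show "?j x y" if "conn p R (insert e T) x y"
    using that eq
  proof (rule conn_least[where S = ?j])
    show "R \<le> ?j" using conn_base_le le(1) by (rule order_trans)
    show "?j (fst (p f)) (snd (p f))" if "f \<in> insert e T" for f
      using that le conn_edge[of f T p R] by (auto simp: le_fun_def)
  qed
  have "?j \<le> conn p R (insert e T)"
    unfolding join_le[OF equivp_conn equivp_conn]
  proof (intro conjI le_funI le_boolI)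
    show "conn p R (insert e T) x y" if "conn p R T x y" for x y
      using that by (rule conn_mono) blast
  qed (rule conn_edge, simp)
  then show "conn p R (insert e T) x y" if "?j x y"
    using that by (rule predicate2D)
qed

text \<open>Acyclicity is expressed as independence: no edge is spanned by \<open>R\<close> and the
  remaining edges. This avoids cycles as lists and behaves well under contraction.\<close>

definition rel_tree :: "('e \<Rightarrow> 'v \<times> 'v) \<Rightarrow> 'v set \<Rightarrow> ('v \<Rightarrow> 'v \<Rightarrow> bool) \<Rightarrow> 'e set \<Rightarrow> bool" where
  "rel_tree p V R T \<longleftrightarrow> (\<forall>x\<in>V. \<forall>y\<in>V. conn p R T x y) \<and>
     (\<forall>e\<in>T. \<not> conn p R (T - {e}) (fst (p e)) (snd (p e)))"

text \<open>
  Matroid exchange: the first edge of \<open>S\<close> that connects \<open>u\<close> with \<open>v\<close> is spanned by the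
  earlier ones together with \<open>uv\<close>.
\<close>

lemma not_conn_independent:
  assumes "equivp R" "finite S" "S \<subseteq> T" "\<not> R u v"
    and indep: "\<And>f. f \<in> T \<Longrightarrow> \<not> conn p (join R u v) (T - {f}) (fst (p f)) (snd (p f))"
  shows "\<not> conn p R S u v"
  using assms(2,3)
proof (induction S)
  case empty
  show ?case unfolding conn_empty[OF assms(1)] by (rule assms(4))
next
  case (insert f S)
  show ?case
  proof
    assume "conn p R (insert f S) u v"
    then have "join (conn p R S) (fst (p f)) (snd (p f)) u v"
      unfolding conn_insert_eq_join .
    moreover have "\<not> conn p R S u v" using insert by simp
    ultimately have j: "join (conn p R S) u v (fst (p f)) (snd (p f))"
      using join_exchange[OF equivp_conn] by metis
    then have "conn p (join R u v) (T - {f}) (fst (p f)) (snd (p f))"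
    proof -
      have "join (conn p R S) u v \<le> conn p (join R u v) (T - {f})"
        unfolding join_le[OF equivp_conn equivp_conn]
      proof
        have "join R u v \<le> conn p (join R u v) (T - {f})"
          by (rule conn_base_le)
        note * = this[unfolded join_le[OF assms(1) equivp_conn]]
        show "conn p R S \<le> conn p (join R u v) (T - {f})"
        proof (intro le_funI le_boolI)
          fix x y
          assume "conn p R S x y"
          then show "conn p (join R u v) (T - {f}) x y"
            using equivp_conn
          proof (rule conn_least[where S = "conn p (join R u v) (T - {f})"])
            show "R \<le> conn p (join R u v) (T - {f})" using * by blast
            show "conn p (join R u v) (T - {f}) (fst (p e)) (snd (p e))" if "e \<in> S" for e
              using that insert by (intro conn_edge) auto
          qed
        qed
        show "conn p (join R u v) (T - {f}) u v" using * by blast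
      qed
      then show ?thesis using j by (rule predicate2D)
    qed
    then show False using indep insert.prems by blast
  qed
qed

text \<open>This mirrors the contraction branch of \<open>tree_sum\<close>. By
  \<open>conn_insert\<close> the edge \<open>e\<close> moves into the base relation for
  connectedness and for the independence of every other edge. The independence of \<open>e\<close>
  itself then reduces to its not being a loop, by \<open>not_conn_independent\<close>.\<close>

lemma rel_tree_insert:
  assumes "equivp R" "finite T" "e \<notin> T"
  shows "rel_tree p V R (insert e T) \<longleftrightarrow>
    \<not> R (fst (p e)) (snd (p e)) \<and> rel_tree p V (join R (fst (p e)) (snd (p e))) T"
proof -
  let ?u = "fst (p e)" and ?v = "snd (p e)"
  have d: "insert e T - {f} = insert e (T - {f})" if "f \<in> T" for f using that assms(3) by auto
  have "(\<forall>f\<in>insert e T. \<not> conn p R (insert e T - {f}) (fst (p f)) (snd (p f))) \<longleftrightarrow>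
     \<not> conn p R T ?u ?v \<and> (\<forall>f\<in>T. \<not> conn p (join R ?u ?v) (T - {f}) (fst (p f)) (snd (p f)))"
    using assms(3) by (auto simp: d conn_insert[OF assms(1)])
  also have "\<dots> \<longleftrightarrow> \<not> R ?u ?v \<and> (\<forall>f\<in>T. \<not> conn p (join R ?u ?v) (T - {f}) (fst (p f)) (snd (p f)))"
  proof (cases "R ?u ?v")
    case True
    then have "conn p R T ?u ?v" by (rule conn_base)
    with True show ?thesis by simp
  next
    case False
    then show ?thesis using not_conn_independent[OF assms(1,2) order_refl False, of p] by auto
  qed
  finally show ?thesis unfolding rel_tree_def conn_insert[OF assms(1)] by blast
qed

text \<open>The trees avoiding \<open>e\<close> are counted by the deletion branch; those containing
  \<open>e\<close> correspond under \<open>insert e\<close> to the trees of the contraction, of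
  which there are none if \<open>e\<close> is a loop.\<close>

lemma tree_sum_eq_card:
  assumes "equivp R" "distinct es"
  shows "tree_sum V (map (\<lambda>e. (fst (p e), snd (p e), 1)) es) R =
    real (card {T. T \<subseteq> set es \<and> rel_tree p V R T})"
  using assms
proof (induction es arbitrary: R)
  case Nil
  have "{T. T \<subseteq> set [] \<and> rel_tree p V R T} = (if \<forall>x\<in>V. \<forall>y\<in>V. R x y then {{}} else {})"
    using Nil by (auto simp: rel_tree_def conn_empty)
  then show ?case by simp
next
  case (Cons e es)
  let ?u = "fst (p e)" and ?v = "snd (p e)"
  let ?A = "{T. T \<subseteq> set es \<and> rel_tree p V R T}"
  let ?B = "{T. T \<subseteq> set es \<and> rel_tree p V (join R ?u ?v) T}"
  have ins: "rel_tree p V R (insert e T) \<longleftrightarrow> \<not> R ?u ?v \<and> rel_tree p V (join R ?u ?v) T"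
    if "T \<subseteq> set es" for T
    using rel_tree_insert[OF Cons.prems(1), of T e] that Cons.prems(2) finite_subset by fastforce
  have "{T. T \<subseteq> set (e # es) \<and> rel_tree p V R T} =
     ?A \<union> insert e ` {T. T \<subseteq> set es \<and> rel_tree p V R (insert e T)}"
  proof (intro equalityI subsetI)
    fix T assume T: "T \<in> {T. T \<subseteq> set (e # es) \<and> rel_tree p V R T}"
    show "T \<in> ?A \<union> insert e ` {T. T \<subseteq> set es \<and> rel_tree p V R (insert e T)}"
    proof (cases "e \<in> T")
      case True
      then have "T = insert e (T - {e})" by auto
      then show ?thesis using T by (intro UnI2 image_eqI[of _ _ "T - {e}"]) auto
    qed (use T in auto)
  qed auto
  also have "{T. T \<subseteq> set es \<and> rel_tree p V R (insert e T)} = (if R ?u ?v then {} else ?B)"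
    using ins by auto
  finally have "card {T. T \<subseteq> set (e # es) \<and> rel_tree p V R T} =
      card (?A \<union> insert e ` (if R ?u ?v then {} else ?B))" by simp
  also have "\<dots> = card ?A + card (insert e ` (if R ?u ?v then {} else ?B))"
    using Cons.prems(2) by (intro card_Un_disjoint) auto
  also have "card (insert e ` (if R ?u ?v then {} else ?B)) = card (if R ?u ?v then {} else ?B)"
  proof (rule card_image)
    show "inj_on (insert e) (if R ?u ?v then {} else ?B)"
      using Cons.prems(2) by (auto simp: inj_on_def split: if_splits)
  qed
  finally show ?case
    using Cons.IH[OF Cons.prems(1)] Cons.IH[OF equivp_join[OF Cons.prems(1)]] Cons.prems by simp
qed

section \<open>Paths and cycles in multigraphs, and the link to \<open>rel_tree\<close>\<close>

text \<open>Simple paths. The list \<open>vs\<close> omits the end point, so it is as long as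
  \<open>es\<close>; growth at the end matches \<open>rtrancl_induct\<close>.\<close>

inductive path :: "('v, 'e) multigraph \<Rightarrow> 'v \<Rightarrow> 'v list \<Rightarrow> 'e list \<Rightarrow> 'v \<Rightarrow> bool" for G u where
  path_Nil: "u \<in> verts G \<Longrightarrow> path G u [] [] u"
| path_snoc: "path G u vs es v \<Longrightarrow> e \<in> edges G \<Longrightarrow> ends G e = {v, w} \<Longrightarrow> w \<in> verts G \<Longrightarrow>
    w \<noteq> v \<Longrightarrow> w \<notin> set vs \<Longrightarrow> path G u (vs @ [v]) (es @ [e]) w"

lemma path_props:
  assumes "path G u vs es v"
  shows "length vs = length es" "distinct (vs @ [v])" "distinct es" "set (vs @ [v]) \<subseteq> verts G"
    "set es \<subseteq> edges G" "hd (vs @ [v]) = u"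
    "\<forall>i<length es. ends G (es ! i) = {(vs @ [v]) ! i, (vs @ [v]) ! Suc i}"
proof -
  \<comment> \<open>The final conjunct strengthens the induction: all earlier edges have their ends
    among the visited vertices, so an edge to a new vertex is itself new.\<close>
  have "length vs = length es \<and> distinct (vs @ [v]) \<and> distinct es \<and> set (vs @ [v]) \<subseteq> verts G \<and>
    set es \<subseteq> edges G \<and> hd (vs @ [v]) = u \<and>
    (\<forall>i<length es. ends G (es ! i) = {(vs @ [v]) ! i, (vs @ [v]) ! Suc i}) \<and>
    (\<forall>e\<in>set es. ends G e \<subseteq> set (vs @ [v]))"
    using assms
  proof induction
    case (path_snoc vs es v e w)
    then show ?case
      by (auto simp: nth_append less_Suc_eq hd_append split: if_splits)
  qed auto
  then show "length vs = length es" "distinct (vs @ [v])" "distinct es" "set (vs @ [v]) \<subseteq> verts G"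
    "set es \<subseteq> edges G" "hd (vs @ [v]) = u"
    "\<forall>i<length es. ends G (es ! i) = {(vs @ [v]) ! i, (vs @ [v]) ! Suc i}"
    by blast+
qed

lemma path_prefix:
  "path G u vs es v \<Longrightarrow> w \<in> set (vs @ [v]) \<Longrightarrow> \<exists>vs' es'. path G u vs' es' w"
proof (induction rule: path.induct)
  case path_Nil
  then show ?case using path.path_Nil by fastforce
next
  case (path_snoc vs es v e x)
  then show ?case using path.path_snoc[OF path_snoc(1-6)] by fastforce
qed

text \<open>Whenever the walk returns to a vertex of the path, the path is cut back to that vertex
  by \<open>path_prefix\<close>.\<close>

lemma adjacency_path:
  assumes "(u, v) \<in> (adjacency G)\<^sup>*" "u \<in> verts G" "\<forall>e\<in>edges G. ends G e \<subseteq> verts G"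
  shows "\<exists>vs es. path G u vs es v"
  using assms(1)
proof (induction rule: rtrancl_induct)
  case base
  then show ?case using path_Nil assms(2) by fast
next
  case (step y z)
  then obtain vs es e where p: "path G u vs es y" and e: "e \<in> edges G" "ends G e = {y, z}"
    by (auto simp: adjacency_def)
  show ?case
  proof (cases "z \<in> set (vs @ [y])")
    case True
    then show ?thesis using path_prefix[OF p] by blast
  next
    case False
    then show ?thesis using path_snoc[OF p e] e assms(3) by fastforce
  qed
qed

lemma adjacency_symp: "(u, v) \<in> (adjacency G)\<^sup>* \<Longrightarrow> (v, u) \<in> (adjacency G)\<^sup>*"
proof -
  have "sym (adjacency G)" by (auto simp: sym_def adjacency_def insert_commute)
  then show "(u, v) \<in> (adjacency G)\<^sup>* \<Longrightarrow> (v, u) \<in> (adjacency G)\<^sup>*"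
    by (meson sym_rtrancl symE)
qed

lemma conn_adjacency:
  assumes "\<And>e. e \<in> T \<Longrightarrow> ends G e = {fst (p e), snd (p e)}"
  shows "conn p (=) T x y \<longleftrightarrow> (x, y) \<in> (adjacency (G\<lparr>edges := T\<rparr>))\<^sup>*"
proof
  let ?S = "\<lambda>x y. (x, y) \<in> (adjacency (G\<lparr>edges := T\<rparr>))\<^sup>*"
  have "equivp ?S"
    by (rule equivpI) (auto simp: reflp_def symp_def transp_def dest: adjacency_symp)
  then show "?S x y" if c: "conn p (=) T x y"
  proof (rule conn_least[where S = ?S, OF c])
    show "?S (fst (p e)) (snd (p e))" if "e \<in> T" for e
      using that assms[OF that] by (intro r_into_rtrancl) (force simp: adjacency_def)
  qed auto
  show "conn p (=) T x y" if "?S x y"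
    using that
  proof (induction rule: rtrancl_induct)
    case base
    show ?case using equivpD(1)[OF equivp_conn] .
  next
    case (step y z)
    then obtain e where e: "e \<in> T" "ends G e = {y, z}" by (auto simp: adjacency_def)
    then have "conn p (=) T (fst (p e)) (snd (p e))" by (simp add: conn_edge)
    moreover have "(fst (p e) = y \<and> snd (p e) = z) \<or> (fst (p e) = z \<and> snd (p e) = y)"
      using e assms by (metis doubleton_eq_iff)
    ultimately have "conn p (=) T y z" using equivpD(2)[OF equivp_conn] by metis
    then show ?case using step(3) equivpD(3)[OF equivp_conn] by metis
  qed
qed

text \<open>The edge removed is the first of the cycle; the remaining edges lead around from its
  second end to its first.\<close>

lemma cycle_ends_connected:
  assumes "is_cycle G vs es"
  shows "\<exists>e\<in>edges G. \<exists>u v. ends G e = {u, v} \<and> (u, v) \<in> (adjacency (G\<lparr>edges := edges G - {e}\<rparr>))\<^sup>*"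
proof -
  let ?e = "es ! 0" and ?n = "length es"
  let ?A = "adjacency (G\<lparr>edges := edges G - {?e}\<rparr>)"
  have c: "0 < ?n" "distinct es" "set es \<subseteq> edges G" "length vs = ?n"
    "\<And>i. i < ?n \<Longrightarrow> ends G (es ! i) = {vs ! i, vs ! (Suc i mod ?n)}"
    using assms by (auto simp: is_cycle_def)
  have step: "(vs ! i, vs ! (Suc i mod ?n)) \<in> ?A" if "0 < i" "i < ?n" for i
  proof -
    have "es ! i \<noteq> ?e" using c that by (metis nth_eq_iff_index_eq less_numeral_extra(3))
    then have "es ! i \<in> edges G - {?e}" using c that by auto
    then show ?thesis using c(5)[OF that(2)] unfolding adjacency_def by auto
  qed
  \<comment> \<open>The index \<open>1 mod ?n\<close> also covers a loop, where the second end is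
    again the vertex at index 0.\<close>
  have walk: "(vs ! (1 mod ?n), vs ! (Suc i mod ?n)) \<in> ?A\<^sup>*" if "i < ?n" for i
    using that
  proof (induction i)
    case (Suc i)
    then have "(vs ! Suc i, vs ! (Suc (Suc i) mod ?n)) \<in> ?A" using step by simp
    then show ?case using Suc by (simp add: rtrancl.rtrancl_into_rtrancl)
  qed simp
  have "Suc (?n - 1) mod ?n = 0" using c(1) by simp
  then have "(vs ! (1 mod ?n), vs ! 0) \<in> ?A\<^sup>*" using walk[of "?n - 1"] c(1) by (metis diff_less zero_less_one)
  moreover have "ends G ?e = {vs ! (1 mod ?n), vs ! 0}" using c(5)[of 0] c(1) by auto
  moreover have "?e \<in> edges G" using c by auto
  ultimately show ?thesis by blast
qed

text \<open>A simple path from \<open>u\<close> to \<open>v\<close> that avoids \<open>e\<close> is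
  closed up by \<open>e\<close>. If \<open>e\<close> is a loop, the path is empty and the cycle has
  length 1.\<close>

lemma ends_connected_cycle:
  assumes "e \<in> edges G" "ends G e = {u, v}" "(u, v) \<in> (adjacency (G\<lparr>edges := edges G - {e}\<rparr>))\<^sup>*"
    "\<forall>e\<in>edges G. ends G e \<subseteq> verts G"
  shows "\<exists>vs es. is_cycle G vs es"
proof -
  let ?G = "G\<lparr>edges := edges G - {e}\<rparr>"
  have "\<exists>vs es. path ?G u vs es v"
    using assms by (intro adjacency_path) auto
  then obtain vs es where p: "path ?G u vs es v" by blast
  note pp = path_props[OF p]
  have "ends G ((es @ [e]) ! i) = {(vs @ [v]) ! i, (vs @ [v]) ! (Suc i mod length (es @ [e]))}"
    if "i < length (es @ [e])" for i
  proof (cases "i < length es")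
    case True
    then show ?thesis using pp(7) by (simp add: nth_append)
  next
    case False
    then have i: "i = length es" using that by simp
    have "(vs @ [v]) ! 0 = u" using pp(6) by (simp add: hd_conv_nth)
    then show ?thesis using i assms(2) pp(1) by (auto simp: nth_append)
  qed
  then have "is_cycle G (vs @ [v]) (es @ [e])"
    using pp(1-5) assms(1) unfolding is_cycle_def by auto
  then show ?thesis by blast
qed

text \<open>Here \<open>p\<close> orients the edges arbitrarily. The core is that a set of edges
  contains a cycle iff some edge of it has ends that stay connected after its removal.\<close>

lemma tau_eq_tree_sum:
  assumes ends: "\<And>e. e \<in> edges G \<Longrightarrow> ends G e = {fst (p e), snd (p e)}"
    and sub: "\<And>e. e \<in> edges G \<Longrightarrow> ends G e \<subseteq> verts G"
    and "verts G \<noteq> {}" "distinct es" "set es = edges G"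
  shows "real (\<tau> G) = tree_sum (verts G) (map (\<lambda>e. (fst (p e), snd (p e), 1)) es) (=)"
proof -
  have "is_tree (G\<lparr>edges := T\<rparr>) \<longleftrightarrow> rel_tree p (verts G) (=) T" if T: "T \<subseteq> edges G" for T
  proof -
    let ?H = "G\<lparr>edges := T\<rparr>"
    have conn: "conn p (=) S x y \<longleftrightarrow> (x, y) \<in> (adjacency (G\<lparr>edges := S\<rparr>))\<^sup>*" if "S \<subseteq> T" for S x y
      using that T ends by (intro conn_adjacency) auto
    have subT: "\<forall>e\<in>T. ends G e \<subseteq> verts G" using sub T by blast
    have "(\<exists>vs es. is_cycle ?H vs es) \<longleftrightarrow>
        (\<exists>e\<in>T. conn p (=) (T - {e}) (fst (p e)) (snd (p e)))"
    proof
      assume "\<exists>vs es. is_cycle ?H vs es"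
      then obtain e u v where e: "e \<in> T" "ends G e = {u, v}"
        and "(u, v) \<in> (adjacency (G\<lparr>edges := T - {e}\<rparr>))\<^sup>*"
        using cycle_ends_connected[of ?H] by fastforce
      then have "conn p (=) (T - {e}) u v" by (simp add: conn)
      moreover have "(fst (p e) = u \<and> snd (p e) = v) \<or> (fst (p e) = v \<and> snd (p e) = u)"
        using e ends T by (metis doubleton_eq_iff subsetD)
      ultimately show "\<exists>e\<in>T. conn p (=) (T - {e}) (fst (p e)) (snd (p e))"
        using equivpD(2)[OF equivp_conn] e(1) by metis
    next
      assume "\<exists>e\<in>T. conn p (=) (T - {e}) (fst (p e)) (snd (p e))"
      then obtain e where e: "e \<in> T" "conn p (=) (T - {e}) (fst (p e)) (snd (p e))" by blast
      then show "\<exists>vs es. is_cycle ?H vs es"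
        using T ends subT by (intro ends_connected_cycle[of e ?H "fst (p e)" "snd (p e)"]) (simp_all add: conn subset_iff)
    qed
    then show ?thesis
      using assms(3) by (auto simp: is_tree_def connected_multigraph_def rel_tree_def conn)
  qed
  then have "spanning_trees G = {T. T \<subseteq> set es \<and> rel_tree p (verts G) (=) T}"
    unfolding spanning_trees_def using assms(5) by auto
  then show ?thesis
    unfolding \<tau>_def tree_sum_eq_card[OF identity_equivp assms(4)] by simp
qed

section \<open>Scaling and elimination of the new vertices\<close>

definition classes :: "('v \<Rightarrow> 'v \<Rightarrow> bool) \<Rightarrow> 'v set \<Rightarrow> 'v set set" where
  "classes R V = (\<lambda>x. {y. R x y}) ` V"

lemma class_eq_iff:
  assumes "equivp R"
  shows "{z. R x z} = {z. R y z} \<longleftrightarrow> R x y"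
proof -
  have "{z. R x z} = {z. R y z} \<longleftrightarrow> R x = R y"
    by (auto simp: set_eq_iff fun_eq_iff)
  also have "\<dots> \<longleftrightarrow> R x y"
    using assms unfolding equivp_def by blast
  finally show ?thesis .
qed

text \<open>The classes of \<open>u\<close> and \<open>v\<close> are replaced by their union, which
  is none of the other classes.\<close>

lemma card_classes_join:
  assumes "equivp R" "finite V" "u \<in> V" "v \<in> V" "\<not> R u v"
  shows "card (classes R V) = Suc (card (classes (join R u v) V))"
proof -
  let ?C = "\<lambda>x. {y. R x y}"
  have CE: "?C x = ?C y \<longleftrightarrow> R x y" for x y
    by (rule class_eq_iff[OF assms(1)])
  have J: "{y. join R u v x y} = (if R x u \<or> R x v then ?C u \<union> ?C v else ?C x)" for x
    unfolding join_def by (auto dest: equivpD(2,3)[OF assms(1)])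
  have "classes (join R u v) V = insert (?C u \<union> ?C v) (classes R V - {?C u, ?C v})"
  proof (intro equalityI subsetI)
    fix X assume "X \<in> classes (join R u v) V"
    then obtain x where "x \<in> V" "X = {y. join R u v x y}" by (auto simp: classes_def)
    then show "X \<in> insert (?C u \<union> ?C v) (classes R V - {?C u, ?C v})"
      unfolding J using CE by (auto simp: classes_def)
  next
    fix X assume X: "X \<in> insert (?C u \<union> ?C v) (classes R V - {?C u, ?C v})"
    show "X \<in> classes (join R u v) V"
    proof (cases "X = ?C u \<union> ?C v")
      case True
      then have "X = {y. join R u v u y}" unfolding J using equivpD(1)[OF assms(1)] by simp
      then show ?thesis using assms(3) by (auto simp: classes_def)
    next
      case False
      then obtain x where x: "x \<in> V" "X = ?C x" "?C x \<noteq> ?C u" "?C x \<noteq> ?C v"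
        using X by (auto simp: classes_def)
      then have "X = {y. join R u v x y}" unfolding J CE by simp
      then show ?thesis using x(1) by (auto simp: classes_def)
    qed
  qed
  moreover have "?C u \<union> ?C v \<notin> classes R V - {?C u, ?C v}"
  proof
    assume "?C u \<union> ?C v \<in> classes R V - {?C u, ?C v}"
    then obtain x where x: "?C u \<union> ?C v = ?C x" "?C x \<noteq> ?C u" by (auto simp: classes_def)
    then have "R x u" using equivpD(1)[OF assms(1)] by blast
    then show False using x(2) CE by blast
  qed
  moreover have fin: "finite (classes R V)" using assms(2) by (simp add: classes_def)
  moreover have "card (classes R V - {?C u, ?C v}) = card (classes R V) - 2"
    and "card (classes R V) \<ge> 2"
  proof -
    have sub: "{?C u, ?C v} \<subseteq> classes R V" using assms(3,4) by (auto simp: classes_def)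
    have c: "card {?C u, ?C v} = 2" using CE assms(5) by simp
    show "card (classes R V - {?C u, ?C v}) = card (classes R V) - 2"
      using card_Diff_subset[OF _ sub] c by simp
    show "card (classes R V) \<ge> 2" using card_mono[OF fin sub] c by simp
  qed
  ultimately show ?thesis by simp
qed

text \<open>Every contraction lowers the number of classes by one until a single class is left, so
  each counted set has one edge fewer than there are classes. The extra factor \<open>r\<close> on
  the left avoids subtraction in the exponent.\<close>

lemma tree_sum_scale:
  assumes "finite V" "V \<noteq> {}" "equivp R" "\<forall>(u, v, w) \<in> set es. u \<in> V \<and> v \<in> V"
  shows "r * tree_sum V (map (\<lambda>(u, v, w). (u, v, r * w)) es) R =
    r ^ card (classes R V) * tree_sum V es R"
  using assms(3,4)
proof (induction es arbitrary: R)
  case Nil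
  show ?case
  proof (cases "\<forall>x\<in>V. \<forall>y\<in>V. R x y")
    case True
    obtain x where x: "x \<in> V" using assms(2) by blast
    have "{z. R y z} = {z. R x z}" if "y \<in> V" for y
      using True that x class_eq_iff[OF Nil(1)] by simp
    then have "classes R V = (\<lambda>_. {z. R x z}) ` V"
      unfolding classes_def by (rule image_cong[OF refl])
    then have "classes R V = {{z. R x z}}" using image_constant[OF x] by simp
    then show ?thesis using True by simp
  next
    case False
    then show ?thesis by (simp only: tree_sum.simps list.map if_False mult_zero_right)
  qed
next
  case (Cons e es)
  obtain u v w where e: "e = (u, v, w)" by (metis prod_cases3)
  have uv: "u \<in> V" "v \<in> V" using Cons.prems(2) e by auto
  have IH: "r * tree_sum V (map (\<lambda>(u, v, w). (u, v, r * w)) es) R =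
      r ^ card (classes R V) * tree_sum V es R"
    by (rule Cons.IH) (use Cons.prems in simp_all)
  show ?case
  proof (cases "R u v")
    case True
    then show ?thesis using IH e by simp
  next
    case False
    have "r * tree_sum V (map (\<lambda>(u, v, w). (u, v, r * w)) es) (join R u v) =
      r ^ card (classes (join R u v) V) * tree_sum V es (join R u v)"
      by (rule Cons.IH) (use Cons.prems equivp_join in simp_all)
    then have "r * (r * w * tree_sum V (map (\<lambda>(u, v, w). (u, v, r * w)) es) (join R u v)) =
      r ^ card (classes R V) * (w * tree_sum V es (join R u v))"
      using card_classes_join[OF Cons.prems(1) assms(1) uv False] by simp
    then show ?thesis using IH e False by (simp add: distrib_left)
  qed
qed

section \<open>Collapsing one subdivided triangle\<close>

fun triangle_edges :: "real \<Rightarrow> 'v \<times> 'v \<times> 'v \<Rightarrow> ('v \<times> 'v \<times> real) list" where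
  "triangle_edges w (a, b, c) = [(a, b, w), (b, c, w), (c, a, w)]"

declare tree_sum.simps [simp del]

text \<open>A midpoint \<open>m\<close> lies on two small triangles, so it has one edge to each of
  \<open>a\<close> and \<open>b\<close> and two to the centre \<open>z\<close>. Merging the latter
  gives a star to which \<open>tree_sum_star_triangle\<close> applies.\<close>

lemma tree_sum_rim_vertex:
  fixes m :: 'v
  assumes "distinct [m, a, b, z]" "a \<in> V" "b \<in> V" "z \<in> V" "m \<notin> V"
    and es: "\<forall>e\<in>set es. fst e \<in> V \<and> fst (snd e) \<in> V"
  shows "tree_sum (insert m V) ((m, a, 1) # (m, b, 1) # (m, z, 1) # (m, z, 1) # es) (=) =
    4 * tree_sum V ((a, b, 1/4) # (b, z, 1/2) # (z, a, 1/2) # es) (=)"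
proof -
  have eq: "equivp ((=) :: 'v \<Rightarrow> 'v \<Rightarrow> bool)" by (rule identity_equivp)
  have es': "\<forall>(u, v, w) \<in> set es. m \<noteq> u \<and> m \<noteq> v" using es assms(5) by fastforce
  have "tree_sum (insert m V) ((m, a, 1) # (m, b, 1) # (m, z, 1) # (m, z, 1) # es) (=) =
      tree_sum (insert m V) ((m, z, 1) # (m, z, 1) # (m, a, 1) # (m, b, 1) # es) (=)"
    by (rule tree_sum_cong[OF eq]) (simp add: add_mset_commute)
  also have "\<dots> = tree_sum (insert m V) ((m, z, 2) # (m, a, 1) # (m, b, 1) # es) (=)"
    unfolding tree_sum_parallel[OF eq] by simp
  also have "\<dots> = tree_sum (insert m V) ((m, a, 1) # (m, b, 1) # (m, z, 2) # es) (=)"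
    by (rule tree_sum_cong[OF eq]) (simp add: add_mset_commute)
  also have "\<dots> = 4 * tree_sum V ((a, b, 1/4) # (b, z, 1/2) # (z, a, 1/2) # es) (=)"
    using tree_sum_star_triangle[OF assms(1-5) es', of 1 1 2] by simp
  finally show ?thesis .
qed

text \<open>
  Each of \<open>p, q, r\<close> is a star with weights 1, 1, 2, which contributes the factor 4. Afterwards
  \<open>z\<close> is a star with weights 3, 3, 3, which contributes the factor 9.
\<close>

lemma tree_sum_wheel:
  fixes a :: 'v
  assumes d: "distinct [a, b, c, p, q, r, z]" and V: "a \<in> V" "b \<in> V" "c \<in> V"
    "p \<notin> V" "q \<notin> V" "r \<notin> V" "z \<notin> V" and es: "\<forall>e\<in>set es. fst e \<in> V \<and> fst (snd e) \<in> V"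
  shows "tree_sum (insert p (insert q (insert r (insert z V))))
      (concat (map (triangle_edges 1)
        [(a, p, z), (p, b, z), (b, q, z), (q, c, z), (c, r, z), (r, a, z)]) @ es) (=) =
    576 * tree_sum V (triangle_edges (5/4) (a, b, c) @ es) (=)" (is "?L = _")
proof -
  let ?I = "(=) :: 'v \<Rightarrow> 'v \<Rightarrow> bool"
  have eq: "equivp ?I" by (rule identity_equivp)
  note cong = tree_sum_cong[OF eq]
  \<comment> \<open>\<open>?S\<close> is the double edge between the centre and a corner,
    \<open>?P\<close> the star at a rim vertex, and \<open>?Q\<close> the triangle replacing that
    star.\<close>
  let ?S = "\<lambda>x. [(z, x, 1), (z, x, 1)] :: ('v \<times> 'v \<times> real) list"
  let ?P = "\<lambda>m x y. [(m, x, 1), (m, y, 1), (m, z, 1), (m, z, 1)] :: ('v \<times> 'v \<times> real) list"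
  let ?Q = "\<lambda>x y. [(x, y, 1/4), (y, z, 1/2), (z, x, 1/2)] :: ('v \<times> 'v \<times> real) list"
  have parallel4: "tree_sum W ((z, x, 1/2) # (z, x, 1/2) # (z, x, 1) # (z, x, 1) # fs) ?I =
      tree_sum W ((z, x, 3) # fs) ?I" for W x fs
    unfolding tree_sum_parallel[OF eq] by simp
  have es': "\<forall>(u, v, w) \<in> set es. z \<noteq> u \<and> z \<noteq> v" using es V by fastforce
  have "?L = tree_sum (insert p (insert q (insert r (insert z V))))
      (?P p a b @ ?P q b c @ ?P r c a @ ?S a @ ?S b @ ?S c @ es) ?I"
    by (rule cong) (simp add: add_mset_commute insert_commute)
  also have "\<dots> = 4 * tree_sum (insert q (insert r (insert z V)))
      (?Q a b @ ?P q b c @ ?P r c a @ ?S a @ ?S b @ ?S c @ es) ?I"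
    using tree_sum_rim_vertex[of p a b z "insert q (insert r (insert z V))"
        "?P q b c @ ?P r c a @ ?S a @ ?S b @ ?S c @ es"] d V es by auto
  also have "tree_sum (insert q (insert r (insert z V)))
      (?Q a b @ ?P q b c @ ?P r c a @ ?S a @ ?S b @ ?S c @ es) ?I =
    tree_sum (insert q (insert r (insert z V)))
      (?P q b c @ ?P r c a @ ?Q a b @ ?S a @ ?S b @ ?S c @ es) ?I"
    by (rule cong) simp
  also have "\<dots> = 4 * tree_sum (insert r (insert z V))
      (?Q b c @ ?P r c a @ ?Q a b @ ?S a @ ?S b @ ?S c @ es) ?I"
    using tree_sum_rim_vertex[of q b c z "insert r (insert z V)"
        "?P r c a @ ?Q a b @ ?S a @ ?S b @ ?S c @ es"] d V es by auto
  also have "tree_sum (insert r (insert z V))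
      (?Q b c @ ?P r c a @ ?Q a b @ ?S a @ ?S b @ ?S c @ es) ?I =
    tree_sum (insert r (insert z V))
      (?P r c a @ ?Q b c @ ?Q a b @ ?S a @ ?S b @ ?S c @ es) ?I"
    by (rule cong) simp
  also have "\<dots> = 4 * tree_sum (insert z V)
      (?Q c a @ ?Q b c @ ?Q a b @ ?S a @ ?S b @ ?S c @ es) ?I"
    using tree_sum_rim_vertex[of r c a z "insert z V"
        "?Q b c @ ?Q a b @ ?S a @ ?S b @ ?S c @ es"] d V es by auto
  also have "tree_sum (insert z V) (?Q c a @ ?Q b c @ ?Q a b @ ?S a @ ?S b @ ?S c @ es) ?I =
    tree_sum (insert z V) ([(z, c, 1/2), (z, c, 1/2), (z, c, 1), (z, c, 1)] @
      [(z, b, 1/2), (z, b, 1/2), (z, b, 1), (z, b, 1)] @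
      [(z, a, 1/2), (z, a, 1/2), (z, a, 1), (z, a, 1)] @
      [(a, b, 1/4), (b, c, 1/4), (c, a, 1/4)] @ es) ?I"
    by (rule cong) (simp add: add_mset_commute insert_commute)
  also have "\<dots> = tree_sum (insert z V) ((z, c, 3) # [(z, b, 1/2), (z, b, 1/2), (z, b, 1), (z, b, 1)] @
      [(z, a, 1/2), (z, a, 1/2), (z, a, 1), (z, a, 1)] @ [(a, b, 1/4), (b, c, 1/4), (c, a, 1/4)] @ es) ?I"
    unfolding append_Cons append_Nil parallel4 ..
  also have "\<dots> = tree_sum (insert z V) ([(z, b, 1/2), (z, b, 1/2), (z, b, 1), (z, b, 1)] @
      [(z, a, 1/2), (z, a, 1/2), (z, a, 1), (z, a, 1)] @ (z, c, 3) # [(a, b, 1/4), (b, c, 1/4), (c, a, 1/4)] @ es) ?I"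
    by (rule cong) (simp add: add_mset_commute)
  also have "\<dots> = tree_sum (insert z V) ((z, b, 3) # [(z, a, 1/2), (z, a, 1/2), (z, a, 1), (z, a, 1)] @
      (z, c, 3) # [(a, b, 1/4), (b, c, 1/4), (c, a, 1/4)] @ es) ?I"
    unfolding append_Cons append_Nil parallel4 ..
  also have "\<dots> = tree_sum (insert z V) ([(z, a, 1/2), (z, a, 1/2), (z, a, 1), (z, a, 1)] @
      (z, b, 3) # (z, c, 3) # [(a, b, 1/4), (b, c, 1/4), (c, a, 1/4)] @ es) ?I"
    by (rule cong) (simp add: add_mset_commute)
  also have "\<dots> = tree_sum (insert z V)
      ((z, a, 3) # (z, b, 3) # (z, c, 3) # [(a, b, 1/4), (b, c, 1/4), (c, a, 1/4)] @ es) ?I"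
    unfolding append_Cons append_Nil parallel4 ..
  \<comment> \<open>The new sides have weight \<open>3 * 3 / 9 = 1\<close>; they are parallel to
    those of weight \<open>1/4\<close> left by the rim vertices, which gives
    \<open>5/4\<close>.\<close>
  also have "\<dots> = 9 * tree_sum V
      ([(a, b, 1), (b, c, 1), (c, a, 1)] @ [(a, b, 1/4), (b, c, 1/4), (c, a, 1/4)] @ es) ?I"
    using tree_sum_star_triangle[of z a b c V "[(a, b, 1/4), (b, c, 1/4), (c, a, 1/4)] @ es" 3 3 3]
      d V es' by auto
  also have "tree_sum V
      ([(a, b, 1), (b, c, 1), (c, a, 1)] @ [(a, b, 1/4), (b, c, 1/4), (c, a, 1/4)] @ es) ?I =
    tree_sum V ((a, b, 1) # (a, b, 1/4) # [(b, c, 1), (b, c, 1/4), (c, a, 1), (c, a, 1/4)] @ es) ?I"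
    by (rule cong) (simp add: add_mset_commute)
  also have "\<dots> =
      tree_sum V ((a, b, 1 + 1/4) # [(b, c, 1), (b, c, 1/4), (c, a, 1), (c, a, 1/4)] @ es) ?I"
    by (rule tree_sum_parallel[OF eq])
  also have "\<dots> =
      tree_sum V ((b, c, 1) # (b, c, 1/4) # [(c, a, 1), (c, a, 1/4), (a, b, 5/4)] @ es) ?I"
    by (rule cong) (simp add: add_mset_commute)
  also have "\<dots> =
      tree_sum V ((b, c, 1 + 1/4) # [(c, a, 1), (c, a, 1/4), (a, b, 5/4)] @ es) ?I"
    unfolding append_Cons append_Nil by (rule tree_sum_parallel[OF eq])
  also have "\<dots> = tree_sum V ((c, a, 1) # (c, a, 1/4) # [(a, b, 5/4), (b, c, 5/4)] @ es) ?I"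
    by (rule cong) (simp add: add_mset_commute)
  also have "\<dots> = tree_sum V ((c, a, 1 + 1/4) # [(a, b, 5/4), (b, c, 5/4)] @ es) ?I"
    unfolding append_Cons append_Nil by (rule tree_sum_parallel[OF eq])
  also have "\<dots> = tree_sum V (triangle_edges (5/4) (a, b, c) @ es) ?I"
    by (rule cong) (simp add: add_mset_commute)
  finally show ?thesis by simp
qed

section \<open>The gasket graphs\<close>

definition corners :: "triangle \<Rightarrow> vertex set" where
  "corners t = (case t of (a, b, c) \<Rightarrow> {a, b, c})"

definition new_vertices :: "triangle \<Rightarrow> vertex set" where
  "new_vertices t = (case t of (a, b, c) \<Rightarrow> {Mab a b c, Mbc a b c, Mca a b c, Ctr a b c})"

fun subdivision :: "triangle \<Rightarrow> triangle list" where
  "subdivision (a, b, c) =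
     [(a, Mab a b c, Ctr a b c), (Mab a b c, b, Ctr a b c),
      (b, Mbc a b c, Ctr a b c), (Mbc a b c, c, Ctr a b c),
      (c, Mca a b c, Ctr a b c), (Mca a b c, a, Ctr a b c)]"

primrec triangle_list :: "nat \<Rightarrow> triangle list" where
  "triangle_list 0 = [(X1, X2, X3)]"
| "triangle_list (Suc n) = concat (map subdivision (triangle_list n))"

definition gasket_verts :: "nat \<Rightarrow> vertex set" where
  "gasket_verts n = \<Union> (corners ` triangles n)"

lemma set_subdivision: "set (subdivision t) = subdivide t"
  by (cases t rule: subdivision.cases) simp

lemma set_triangle_list: "set (triangle_list n) = triangles n"
  by (induction n) (auto simp: set_subdivision)

lemma length_triangle_list: "length (triangle_list n) = 6 ^ n"
proof (induction n)
  case (Suc n)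
  have "length (subdivision t) = 6" for t by (cases t rule: subdivision.cases) simp
  then have "length (concat (map subdivision ts)) = 6 * length ts" for ts
    by (induction ts) simp_all
  then show ?case using Suc by simp
qed simp

lemma new_vertices_disjoint: "t \<noteq> u \<Longrightarrow> new_vertices t \<inter> new_vertices u = {}"
  by (cases t; cases u) (auto simp: new_vertices_def)

text \<open>A new vertex contains all corners of its triangle as proper subterms, so it is strictly
  larger than each of them.\<close>

lemma corners_new_vertices:
  assumes "v \<in> corners t"
  shows "v \<notin> new_vertices t"
proof
  assume "v \<in> new_vertices t"
  then have "size v < size v" using assms by (cases t) (auto simp: new_vertices_def corners_def)
  then show False by simp
qed

lemma corner_neq [simp]:
  "a \<noteq> Mab a b c" "a \<noteq> Mca a b c" "a \<noteq> Ctr a b c"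
  "b \<noteq> Mab a b c" "b \<noteq> Mbc a b c" "b \<noteq> Ctr a b c"
  "c \<noteq> Mbc a b c" "c \<noteq> Mca a b c" "c \<noteq> Ctr a b c"
  using corners_new_vertices[of _ "(a, b, c)"] by (auto simp: corners_def new_vertices_def)

lemmas corner_neq_sym [simp] = corner_neq[symmetric]

text \<open>
  The largest depth of a corner of a triangle of \<open>triangles n\<close> is exactly \<open>n\<close>; hence the
  vertices created from it do not occur in earlier graphs.
\<close>

primrec depth :: "vertex \<Rightarrow> nat" where
  "depth X1 = 0" | "depth X2 = 0" | "depth X3 = 0"
| "depth (Mab a b c) = Suc (Max {depth a, depth b, depth c})"
| "depth (Mbc a b c) = Suc (Max {depth a, depth b, depth c})"
| "depth (Mca a b c) = Suc (Max {depth a, depth b, depth c})"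
| "depth (Ctr a b c) = Suc (Max {depth a, depth b, depth c})"

lemma triangles_depth: "(a, b, c) \<in> triangles n \<Longrightarrow> Max {depth a, depth b, depth c} = n"
proof (induction n arbitrary: a b c)
  case (Suc n)
  then obtain x y z where "(x, y, z) \<in> triangles n" and t: "(a, b, c) \<in> subdivide (x, y, z)"
    by auto
  then have "Max {depth x, depth y, depth z} = n" using Suc.IH by blast
  then have m: "max (depth x) (max (depth y) (depth z)) = n" by simp
  then have "depth x \<le> n" "depth y \<le> n" "depth z \<le> n" by auto
  with t m show ?case by auto
qed simp

lemma triangles_distinct: "(a, b, c) \<in> triangles n \<Longrightarrow> distinct [a, b, c]"
proof (induction n arbitrary: a b c)
  case (Suc n)
  then obtain x y z where "(a, b, c) \<in> subdivide (x, y, z)"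
    by auto
  then show ?case by auto
qed simp

lemma depth_gasket_verts:
  assumes "v \<in> gasket_verts n"
  shows "depth v \<le> n"
proof -
  obtain a b c where "(a, b, c) \<in> triangles n" and v: "v \<in> {a, b, c}"
    using assms by (auto simp: gasket_verts_def corners_def)
  then have "Max {depth a, depth b, depth c} = n" by (intro triangles_depth)
  then show ?thesis using v by auto
qed

lemma depth_new_vertices:
  assumes "t \<in> triangles n" "v \<in> new_vertices t"
  shows "depth v = Suc n"
proof -
  obtain a b c where t: "t = (a, b, c)" by (metis prod_cases3)
  then have "Max {depth a, depth b, depth c} = n" using assms(1) by (intro triangles_depth) simp
  then show ?thesis using assms(2) t by (auto simp: new_vertices_def)
qed

lemma new_vertices_gasket_verts:
  assumes "t \<in> triangles n"
  shows "new_vertices t \<inter> gasket_verts n = {}"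
proof -
  have False if "v \<in> new_vertices t" "v \<in> gasket_verts n" for v
    using depth_gasket_verts[OF that(2)] depth_new_vertices[OF assms that(1)] by simp
  then show ?thesis by blast
qed

lemma distinct_triangle_list: "distinct (triangle_list n)"
proof (induction n)
  case (Suc n)
  have d: "distinct (subdivision t)" for t
    by (cases t) auto
  \<comment> \<open>The last vertex of a small triangle determines its parent, so different parents
    have disjoint subdivisions.\<close>
  have c: "snd (snd s) = Ctr a b c" if "s \<in> set (subdivision (a, b, c))" for s a b c
    using that by auto
  have disj: "set (subdivision t) \<inter> set (subdivision u) = {}" if "t \<noteq> u" for t u
  proof -
    obtain a b c x y z where tu: "t = (a, b, c)" "u = (x, y, z)" by (metis prod_cases3)
    then have "Ctr a b c \<noteq> Ctr x y z" using that by simp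
    then have False if "s \<in> set (subdivision t)" "s \<in> set (subdivision u)" for s
      using c[of s a b c] c[of s x y z] that unfolding tu by simp
    then show ?thesis by blast
  qed
  have "distinct (concat (map subdivision ts))" if "distinct ts" for ts
    using that
  proof (induction ts)
    case (Cons t ts)
    have "set (subdivision t) \<inter> set (subdivision u) = {}" if "u \<in> set ts" for u
      by (rule disj) (use that Cons.prems in auto)
    then have "set (subdivision t) \<inter> (\<Union>u\<in>set ts. set (subdivision u)) = {}"
      by blast
    moreover have "distinct (concat (map subdivision ts))" using Cons by simp
    ultimately show ?case using d[of t] by simp
  qed simp
  then show ?case using Suc by simp
qed simp

lemma gasket_verts_Suc:
  "gasket_verts (Suc n) = gasket_verts n \<union> \<Union> (new_vertices ` triangles n)"
proof -
  have "\<Union> (corners ` subdivide t) = corners t \<union> new_vertices t" for t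
    by (cases t) (auto simp: corners_def new_vertices_def)
  then show ?thesis by (auto simp: gasket_verts_def)
qed

lemma finite_gasket_verts: "finite (gasket_verts n)"
  unfolding gasket_verts_def set_triangle_list[symmetric] by (auto simp: corners_def)

text \<open>Each of the \<open>6 ^ n\<close> triangles contributes four new vertices; the factor 5
  clears the denominator of the geometric sum.\<close>

lemma card_gasket_verts: "5 * card (gasket_verts n) = 4 * 6 ^ n + 11"
proof (induction n)
  case 0
  show ?case by (simp add: gasket_verts_def corners_def)
next
  case (Suc n)
  have fin: "finite (triangles n)" by (metis set_triangle_list finite_set)
  have c4: "card (new_vertices t) = 4" for t
    by (cases t) (simp add: new_vertices_def)
  then have fn: "finite (new_vertices t)" for t
    by (metis card.infinite zero_neq_numeral)
  have "card (triangles n) = 6 ^ n"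
    using distinct_card[OF distinct_triangle_list, of n]
    by (simp add: set_triangle_list length_triangle_list)
  then have "card (\<Union> (new_vertices ` triangles n)) = 4 * 6 ^ n"
    using fin fn new_vertices_disjoint by (subst card_UN_disjoint) (auto simp: c4)
  moreover have "gasket_verts n \<inter> \<Union> (new_vertices ` triangles n) = {}"
    using new_vertices_gasket_verts by fast
  ultimately have "card (gasket_verts (Suc n)) = card (gasket_verts n) + 4 * 6 ^ n"
    unfolding gasket_verts_Suc using fin fn by (subst card_Un_disjoint) (auto simp: finite_gasket_verts)
  then show ?case using Suc by simp
qed

section \<open>The recursion for the gasket graphs\<close>

text \<open>The triangles are collapsed one at a time by \<open>tree_sum_wheel\<close>. The
  arbitrary edges \<open>es\<close> on the old vertices make the induction work: a collapsed
  triangle is moved there with its weight \<open>5/4\<close>.\<close>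

lemma tree_sum_subdivision:
  assumes "distinct ts"
    and "\<And>a b c. (a, b, c) \<in> set ts \<Longrightarrow> distinct [a, b, c]"
    and "\<And>t. t \<in> set ts \<Longrightarrow> corners t \<subseteq> V"
    and "\<And>t. t \<in> set ts \<Longrightarrow> new_vertices t \<inter> V = {}"
    and "\<forall>e\<in>set es. fst e \<in> V \<and> fst (snd e) \<in> V"
  shows "tree_sum (V \<union> \<Union> (new_vertices ` set ts))
      (concat (map (triangle_edges 1) (concat (map subdivision ts))) @ es) (=) =
    576 ^ length ts * tree_sum V (concat (map (triangle_edges (5/4)) ts) @ es) (=)"
  using assms
proof (induction ts arbitrary: es)
  case (Cons t ts)
  obtain a b c where t: "t = (a, b, c)" by (metis prod_cases3)
  let ?W = "V \<union> \<Union> (new_vertices ` set ts)"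
  let ?rest = "concat (map (triangle_edges 1) (concat (map subdivision ts))) @ es"
  let ?new = "[Mab a b c, Mbc a b c, Mca a b c, Ctr a b c]"
  have "new_vertices t \<inter> new_vertices s = {}" if "s \<in> set ts" for s
    by (rule new_vertices_disjoint) (use that Cons.prems(1) in auto)
  moreover have "new_vertices t \<inter> V = {}" by (rule Cons.prems(4)) simp
  ultimately have new: "new_vertices t \<inter> ?W = {}" by blast
  have sub: "\<forall>e\<in>set (concat (map (triangle_edges 1) (subdivision s))).
      fst e \<in> corners s \<union> new_vertices s \<and> fst (snd e) \<in> corners s \<union> new_vertices s" for s
    by (cases s) (auto simp: corners_def new_vertices_def)
  have rest: "\<forall>e\<in>set ?rest. fst e \<in> ?W \<and> fst (snd e) \<in> ?W"
  proof
    fix e assume "e \<in> set ?rest"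
    then consider "e \<in> set es" | s where "s \<in> set ts"
      "e \<in> set (concat (map (triangle_edges 1) (subdivision s)))" by auto
    then show "fst e \<in> ?W \<and> fst (snd e) \<in> ?W"
    proof cases
      case 1
      then show ?thesis using Cons.prems(5) by simp
    next
      case 2
      have "corners s \<subseteq> V" by (rule Cons.prems(3)) (use 2 in simp)
      then have "corners s \<union> new_vertices s \<subseteq> ?W" using 2(1) by blast
      then show ?thesis using bspec[OF sub 2(2)] by blast
    qed
  qed
  have c: "a \<in> V" "b \<in> V" "c \<in> V" using Cons.prems(3)[of t] t by (auto simp: corners_def)
  have ne: "a \<notin> set ?new" "b \<notin> set ?new" "c \<notin> set ?new"
    using corners_new_vertices[of _ t] t by (auto simp: corners_def new_vertices_def)
  have dist: "distinct [a, b, c, Mab a b c, Mbc a b c, Mca a b c, Ctr a b c]"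
    using Cons.prems(2)[of a b c] t ne by auto
  have nW: "Mab a b c \<notin> ?W" "Mbc a b c \<notin> ?W" "Mca a b c \<notin> ?W" "Ctr a b c \<notin> ?W"
    using new t by (auto simp: new_vertices_def)
  have "V \<union> \<Union> (new_vertices ` set (t # ts)) =
      insert (Mab a b c) (insert (Mbc a b c) (insert (Mca a b c) (insert (Ctr a b c) ?W)))"
    using t by (auto simp: new_vertices_def)
  then have "tree_sum (V \<union> \<Union> (new_vertices ` set (t # ts)))
      (concat (map (triangle_edges 1) (concat (map subdivision (t # ts)))) @ es) (=) =
    tree_sum (insert (Mab a b c) (insert (Mbc a b c) (insert (Mca a b c) (insert (Ctr a b c) ?W))))
      (concat (map (triangle_edges 1) (subdivision (a, b, c))) @ ?rest) (=)"
    using t by simp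
  also have "\<dots> = 576 * tree_sum ?W (triangle_edges (5/4) t @ ?rest) (=)"
    unfolding t subdivision.simps
    by (rule tree_sum_wheel[OF dist _ _ _ nW rest]) (use c in auto)
  also have "tree_sum ?W (triangle_edges (5/4) t @ ?rest) (=) =
      tree_sum ?W (concat (map (triangle_edges 1) (concat (map subdivision ts))) @
        (triangle_edges (5/4) t @ es)) (=)"
    by (rule tree_sum_cong[OF identity_equivp]) simp
  also have "\<dots> = 576 ^ length ts *
      tree_sum V (concat (map (triangle_edges (5/4)) ts) @ (triangle_edges (5/4) t @ es)) (=)"
  proof (rule Cons.IH)
    show "distinct ts" using Cons.prems(1) by simp
    show "distinct [x, y, z]" if "(x, y, z) \<in> set ts" for x y z
      by (rule Cons.prems(2)) (use that in simp)
    show "corners s \<subseteq> V" "new_vertices s \<inter> V = {}" if "s \<in> set ts" for s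
      by (rule Cons.prems(3,4); use that in simp)+
    show "\<forall>e\<in>set (triangle_edges (5/4) t @ es). fst e \<in> V \<and> fst (snd e) \<in> V"
      using Cons.prems(5) c t by simp
  qed
  also have "tree_sum V (concat (map (triangle_edges (5/4)) ts) @ (triangle_edges (5/4) t @ es)) (=) =
      tree_sum V (concat (map (triangle_edges (5/4)) (t # ts)) @ es) (=)"
    by (rule tree_sum_cong[OF identity_equivp]) simp
  finally show ?case by (simp only: length_Cons power_Suc mult.assoc)
qed simp

definition gasket_tree_sum :: "nat \<Rightarrow> real" where
  "gasket_tree_sum n =
     tree_sum (gasket_verts n) (concat (map (triangle_edges 1) (triangle_list n))) (=)"

lemma corners_subset_gasket_verts: "t \<in> triangles n \<Longrightarrow> corners t \<subseteq> gasket_verts n"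
  by (auto simp: gasket_verts_def)

text \<open>After all triangles are collapsed, every edge has weight \<open>5/4\<close>, and
  \<open>tree_sum_scale\<close> extracts it. The classes of equality are singletons, so the exponent
  is the number of vertices.\<close>

lemma gasket_tree_sum_Suc:
  "5/4 * gasket_tree_sum (Suc n) =
     576 ^ (6 ^ n) * (5/4) ^ card (gasket_verts n) * gasket_tree_sum n"
proof -
  let ?V = "gasket_verts n" and ?ts = "triangle_list n"
  have "gasket_tree_sum (Suc n) = tree_sum (?V \<union> \<Union> (new_vertices ` set ?ts))
      (concat (map (triangle_edges 1) (concat (map subdivision ?ts))) @ []) (=)"
    by (simp add: gasket_tree_sum_def gasket_verts_Suc set_triangle_list)
  also have "\<dots> =
      576 ^ length ?ts * tree_sum ?V (concat (map (triangle_edges (5/4)) ?ts) @ []) (=)"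
  proof (rule tree_sum_subdivision[OF distinct_triangle_list])
    show "distinct [a, b, c]" if "(a, b, c) \<in> set ?ts" for a b c
      using that triangles_distinct unfolding set_triangle_list by blast
    show "corners t \<subseteq> ?V" if "t \<in> set ?ts" for t
      using that corners_subset_gasket_verts unfolding set_triangle_list by blast
    show "new_vertices t \<inter> ?V = {}" if "t \<in> set ?ts" for t
      using that new_vertices_gasket_verts unfolding set_triangle_list by blast
  qed simp
  finally have sub: "gasket_tree_sum (Suc n) =
      576 ^ (6 ^ n) * tree_sum ?V (concat (map (triangle_edges (5/4)) ?ts)) (=)"
    by (simp add: length_triangle_list)
  have scaled: "map (\<lambda>(u, v, w). (u, v, r * w)) (concat (map (triangle_edges 1) ts)) =
      concat (map (triangle_edges r) ts)" for r and ts :: "triangle list"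
    by (induction ts) auto
  have "classes (=) ?V = (\<lambda>x. {x}) ` ?V" by (simp add: classes_def)
  then have cl: "card (classes (=) ?V) = card ?V" by (simp add: card_image)
  have ne: "?V \<noteq> {}" using card_gasket_verts[of n] by auto
  have inV: "\<forall>(u, v, w) \<in> set (concat (map (triangle_edges 1) ?ts)). u \<in> ?V \<and> v \<in> ?V"
  proof -
    have "\<forall>(u, v, w) \<in> set (triangle_edges 1 t). u \<in> ?V \<and> v \<in> ?V" if "t \<in> triangles n" for t
      using corners_subset_gasket_verts[OF that] by (cases t) (auto simp: corners_def)
    then show ?thesis by (simp add: set_triangle_list)
  qed
  have "5/4 * tree_sum ?V (concat (map (triangle_edges (5/4)) ?ts)) (=) =
      (5/4) ^ card ?V * gasket_tree_sum n"
    using tree_sum_scale[OF finite_gasket_verts ne identity_equivp inV, of "5/4"]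
    unfolding scaled cl gasket_tree_sum_def .
  then show ?thesis unfolding sub by simp
qed

section \<open>From the recursion to the closed formula\<close>

fun side_pair :: "triangle \<times> side \<Rightarrow> vertex \<times> vertex" where
  "side_pair ((a, b, c), AB) = (a, b)"
| "side_pair ((a, b, c), BC) = (b, c)"
| "side_pair ((a, b, c), CA) = (c, a)"

lemma tau_gasket_graph: "real (\<tau> (gasket_graph n)) = gasket_tree_sum n"
proof -
  let ?sides = "\<lambda>t :: triangle. [(t, AB), (t, BC), (t, CA)]"
  let ?es = "concat (map ?sides (triangle_list n))"
  have V: "verts (gasket_graph n) = gasket_verts n"
    by (auto simp: gasket_graph_def gasket_verts_def corners_def)
  have ends: "side_ends e = {fst (side_pair e), snd (side_pair e)}" for e
    by (cases e rule: side_ends.cases) simp_all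
  have "real (\<tau> (gasket_graph n)) = tree_sum (verts (gasket_graph n))
      (map (\<lambda>e. (fst (side_pair e), snd (side_pair e), 1)) ?es) (=)"
  proof (rule tau_eq_tree_sum)
    show "ends (gasket_graph n) e = {fst (side_pair e), snd (side_pair e)}" for e
      by (simp add: gasket_graph_def ends)
    show "ends (gasket_graph n) e \<subseteq> verts (gasket_graph n)" if e: "e \<in> edges (gasket_graph n)" for e
    proof -
      have "fst e \<in> triangles n" using e by (auto simp: gasket_graph_def)
      moreover have "side_ends e \<subseteq> corners (fst e)"
        by (cases e rule: side_ends.cases) (auto simp: corners_def)
      ultimately show ?thesis
        unfolding V using corners_subset_gasket_verts by (fastforce simp: gasket_graph_def)
    qed
    show "verts (gasket_graph n) \<noteq> {}"
      unfolding V using card_gasket_verts[of n] by auto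
    have "distinct (concat (map ?sides ts))" if "distinct ts" for ts
      using that by (induction ts) auto
    then show "distinct ?es" using distinct_triangle_list by blast
    have "UNIV = {AB, BC, CA}" using side.exhaust by blast
    then show "set ?es = edges (gasket_graph n)"
      by (auto simp: gasket_graph_def set_triangle_list)
  qed
  also have "map (\<lambda>e. (fst (side_pair e), snd (side_pair e), 1)) (concat (map ?sides ts)) =
      concat (map (triangle_edges 1) ts)" for ts
    by (induction ts) auto
  finally show ?thesis unfolding V gasket_tree_sum_def .
qed

lemma tau_gasket_graph_0: "\<tau> (gasket_graph 0) = 3"
proof -
  have "gasket_tree_sum 0 = 3"
    by (simp add: gasket_tree_sum_def gasket_verts_def corners_def tree_sum.simps join_def)
  then show ?thesis using tau_gasket_graph[of 0] by simp
qed

theorem theorem5p3: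
  fixes n :: nat
  shows "real (\<tau> (gasket_graph n)) =
    2 powr (2 / 25 * (11 * 6 ^ n - 30 * real n - 11)) *
    3 powr (1 / 5 * (2 * 6 ^ n + 3)) *
    5 powr (1 / 25 * (4 * 6 ^ n + 30 * real n - 4))"
proof (induction n)
  case 0
  show ?case by (simp add: tau_gasket_graph_0)
next
  case (Suc n)
  \<comment> \<open>The number of edges of a spanning tree; passing to it cancels the factor
    \<open>5/4\<close> in \<open>gasket_tree_sum_Suc\<close>.\<close>
  define k where "k = card (gasket_verts n) - 1"
  have "card (gasket_verts n) = Suc k" and k: "5 * k = 4 * 6 ^ n + 6"
    using card_gasket_verts[of n] by (simp_all add: k_def)
  then have rec: "real (\<tau> (gasket_graph (Suc n))) =
      576 ^ (6 ^ n) * (5/4) ^ k * real (\<tau> (gasket_graph n))"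
    using gasket_tree_sum_Suc[of n] by (simp add: tau_gasket_graph)
  have "real (5 * k) = real (4 * 6 ^ n + 6)" unfolding k ..
  then have rk: "real k = (4 * 6 ^ n + 6) / 5" by simp
  have p576: "(576 :: real) ^ (6 ^ n) = 2 powr (6 * 6 ^ n) * 3 powr (2 * 6 ^ n)"
  proof -
    have "(576 :: real) ^ (6 ^ n) = (2 ^ 6 * 3 ^ 2) ^ (6 ^ n)" by simp
    also have "\<dots> = 2 ^ (6 * 6 ^ n) * 3 ^ (2 * 6 ^ n)"
      by (simp only: power_mult_distrib power_mult)
    also have "\<dots> = 2 powr real (6 * 6 ^ n) * 3 powr real (2 * 6 ^ n)"
      by (simp only: powr_realpow zero_less_numeral)
    finally show ?thesis by simp
  qed
  have p54: "(5/4 :: real) ^ k = 5 powr real k * 2 powr (- (2 * real k))"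
  proof -
    have "(5/4 :: real) ^ k = 5 ^ k / 2 ^ (2 * k)"
      by (simp add: power_divide power_mult)
    also have "\<dots> = 5 powr real k / 2 powr real (2 * k)"
      by (simp only: powr_realpow zero_less_numeral)
    finally show ?thesis by (simp only: powr_minus_divide of_nat_mult of_nat_numeral times_divide_eq_right mult_1_right)
  qed
  \<comment> \<open>Since \<open>576 = 2 ^ 6 * 3 ^ 2\<close>, the recursion raises the exponents of
    2, 3 and 5 by \<open>6 * 6 ^ n - 2 * k\<close>, \<open>2 * 6 ^ n\<close> and \<open>k\<close>,
    which are the increments of the closed forms.\<close>
  have e2: "2 / 25 * (11 * 6 ^ Suc n - 30 * real (Suc n) - 11) =
      2 / 25 * (11 * 6 ^ n - 30 * real n - 11) + 6 * 6 ^ n + - (2 * real k)"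
    and e3: "1 / 5 * (2 * 6 ^ Suc n + 3) = 1 / 5 * (2 * 6 ^ n + 3) + 2 * (6 :: real) ^ n"
    and e5: "1 / 25 * (4 * 6 ^ Suc n + 30 * real (Suc n) - 4) =
      1 / 25 * (4 * 6 ^ n + 30 * real n - 4) + real k"
    unfolding rk by (simp_all add: field_simps)
  show ?case
    unfolding rec Suc.IH p576 p54 e2 e3 e5 powr_add by (simp only: mult_ac)
qed

end
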